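(* The quantity $\sigma_n(t):=\frac{d}{dt}\ln D_n(t)$ satisfies $$(\sigma_n''(t))^2=\frac14\left(t\sigma_n'(t)-\sigma_n(t)\right)^2-4\left(\sigma_n'(t)-\frac n2\right)\sigma_n'(t)\left(\sigma_n'(t)-\frac{n+\gamma}{2}\right),$$ which is a particular Jimbo–Miwa–Okamoto $\sigma$-form of the Painlevé IV equation.
   Context: Let $A\ge 0$, $A+B\ge 0$, $\gamma>-1$. For $t\in\mathbb{R}$ let $w(z,t,\gamma)=e^{-z^2+tz}|z-t|^{\gamma}(A+B\theta(z-t))$ for $z\in\mathbb{R}$, where $\theta(x)=1$ for $x>0$ and $\theta(x)=0$ for $x\le 0$. The Hankel determinant generated by this weight is $$D_n(t)=\det\left(\int_{\mathbb{R}}z^{i+j}w(z,t,\gamma)\,dz\right)_{i,j=0}^{n-1}.$$ Primes denote $d/dt$. *)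

theory Defs
  imports "HOL-Analysis.Analysis" "Jordan_Normal_Form.Determinant"
begin

definition heaviside :: "real \<Rightarrow> real" where
  "heaviside x = (if x > 0 then 1 else 0)"

(* "powr" gives 0 at z = t for every gamma; this only affects the single point z = t. *)
definition weight :: "real \<Rightarrow> real \<Rightarrow> real \<Rightarrow> real \<Rightarrow> real \<Rightarrow> real" where
  "weight A B z t \<gamma> =
     exp (- z\<^sup>2 + t * z) * \<bar>z - t\<bar> powr \<gamma> * (A + B * heaviside (z - t))"

definition hankel_det :: "real \<Rightarrow> real \<Rightarrow> real \<Rightarrow> nat \<Rightarrow> real \<Rightarrow> real" where
  "hankel_det A B \<gamma> n t =
     Determinant.det (Matrix.mat n n (\<lambda>(i, j). LINT z|lborel. z ^ (i + j) * weight A B z t \<gamma>))"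

(* In the degenerate case A = A + B = 0, n > 0 the determinant vanishes identically and
   the library convention ln 0 = 0 makes sigma_n identically 0. *)
definition sigma_n :: "real \<Rightarrow> real \<Rightarrow> real \<Rightarrow> nat \<Rightarrow> real \<Rightarrow> real" where
  "sigma_n A B \<gamma> n = deriv (\<lambda>s. ln (hankel_det A B \<gamma> n s))"

(* The Jimbo-Miwa-Okamoto sigma-form of Painleve IV in Okamoto's normalization (as in the
   NIST Handbook, Section 32.6):
   (h'')^2 - 4 (s h' - h)^2 + 4 h' (h' + 2 theta_0) (h' + 2 theta_inf) = 0. *)
definition JMO_sigma_PIV :: "real \<Rightarrow> real \<Rightarrow> (real \<Rightarrow> real) \<Rightarrow> bool" where
  "JMO_sigma_PIV \<theta>0 \<theta>inf h \<longleftrightarrow>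
     (\<forall>s. h field_differentiable at s \<and> deriv h field_differentiable at s \<and>
          (deriv (deriv h) s)\<^sup>2 - 4 * (s * deriv h s - h s)\<^sup>2
            + 4 * deriv h s * (deriv h s + 2 * \<theta>0) * (deriv h s + 2 * \<theta>inf) = 0)"

end

theory Submission
  imports Defs "HOL-Real_Asymp.Real_Asymp"
begin

text \<open>Translating the integration variable by \<open>t\<close> turns the weight into
  \<open>exp (- x\<^sup>2 - t * x) * \<bar>x\<bar> powr \<gamma> * c x\<close>, where \<open>c\<close> is constant on each half-line. Its moments satisfy
  \<open>\<mu>\<^sub>k' = - \<mu>\<^sub>k\<^sub>+\<^sub>1\<close> (the Toda flow) and, by integration by parts, a Pearson relation.
  Write \<open>P\<^sub>n\<close> for the monic orthogonal polynomials, \<open>\<alpha>\<^sub>n\<close>, \<open>\<beta>\<^sub>n\<close> for their recurrence coefficients and \<open>h\<^sub>n\<close>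
  for their squared norms. The Hankel determinant is \<open>h\<^sub>0 \<cdots> h\<^sub>n\<^sub>-\<^sub>1\<close>, and the Toda flow gives
  \<open>\<sigma> = - (\<alpha>\<^sub>0 + \<cdots> + \<alpha>\<^sub>n\<^sub>-\<^sub>1)\<close>, \<open>\<sigma>' = \<beta>\<^sub>n\<close>, \<open>\<sigma>'' = - \<beta>\<^sub>n (\<alpha>\<^sub>n - \<alpha>\<^sub>n\<^sub>-\<^sub>1)\<close>. The Pearson relation
  gives the ladder equation
  \<open>x P\<^sub>n' = (n - 2 \<beta>\<^sub>n) P\<^sub>n + \<beta>\<^sub>n (2 x + 2 \<alpha>\<^sub>n + t) P\<^sub>n\<^sub>-\<^sub>1\<close>. Its coefficient of \<open>x\<close> to the power \<open>n - 1\<close> is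
  \<open>\<sigma> = - \<beta>\<^sub>n (2 \<alpha>\<^sub>n + 2 \<alpha>\<^sub>n\<^sub>-\<^sub>1 + t)\<close>, and its values at \<open>x = 0\<close> for \<open>n\<close> and \<open>n - 1\<close> form a homogeneous
  linear system for \<open>(P\<^sub>n(0), P\<^sub>n\<^sub>-\<^sub>1(0)) \<noteq> 0\<close>, whose vanishing determinant reads
  \<open>\<beta>\<^sub>n (2 \<alpha>\<^sub>n + t) (2 \<alpha>\<^sub>n\<^sub>-\<^sub>1 + t) = (2 \<beta>\<^sub>n - n) (2 \<beta>\<^sub>n - n - \<gamma>)\<close>.
  Eliminating \<open>\<alpha>\<^sub>n\<close> and \<open>\<alpha>\<^sub>n\<^sub>-\<^sub>1\<close> yields the \<open>\<sigma>\<close>-form.\<close>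

section \<open>Orthogonal polynomials of a positive functional\<close>

definition X :: "real poly" where "X = [:0, 1:]"

lemma coeff_X_mult: "coeff (X * p) i = (case i of 0 \<Rightarrow> 0 | Suc j \<Rightarrow> coeff p j)"
  by (simp add: X_def coeff_pCons split: nat.splits)

lemma coeff_X: "coeff X i = (if i = 1 then 1 else 0)"
  by (simp add: X_def coeff_pCons split: nat.splits)

lemma degree_X_mult_le: "degree p \<le> n \<Longrightarrow> degree (X * p) \<le> Suc n"
  using degree_mult_le[of X p] by (simp add: X_def)

lemma poly_X [simp]: "poly X x = x"
  by (simp add: X_def)

locale positive_functional =
  fixes L :: "real poly \<Rightarrow> real"
  assumes add: "L (p + q) = L p + L q"
    and smult: "L (Polynomial.smult c p) = c * L p"
    and pos: "p \<noteq> 0 \<Longrightarrow> L (p * p) > 0"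
begin

lemma zero [simp]: "L 0 = 0"
  using smult[of 0 0] by simp

lemma diff: "L (p - q) = L p - L q"
  using add[of "p - q" q] by simp

text \<open>The index is shifted by one against the usual numbering: \<open>opoly (Suc n)\<close> is the monic
  orthogonal polynomial of degree \<open>n\<close>, and \<open>opoly 0 = 0\<close> starts the three-term recurrence.
  With \<open>x / 0 = 0\<close> this also gives \<open>beta 0 = 0\<close>.\<close>

fun opoly :: "nat \<Rightarrow> real poly" where
  "opoly 0 = 0"
| "opoly (Suc 0) = 1"
| "opoly (Suc (Suc n)) =
     X * opoly (Suc n)
     - Polynomial.smult (L (X * opoly (Suc n) * opoly (Suc n)) / L (opoly (Suc n) * opoly (Suc n)))
         (opoly (Suc n))
     - Polynomial.smult (L (opoly (Suc n) * opoly (Suc n)) / L (opoly n * opoly n)) (opoly n)"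

definition hn :: "nat \<Rightarrow> real" where
  "hn n = L (opoly (Suc n) * opoly (Suc n))"

definition alpha :: "nat \<Rightarrow> real" where
  "alpha n = L (X * opoly (Suc n) * opoly (Suc n)) / hn n"

definition beta :: "nat \<Rightarrow> real" where
  "beta n = hn n / L (opoly n * opoly n)"

declare opoly.simps(3) [simp del]

lemma three_term:
  "X * opoly (Suc n) = opoly (Suc (Suc n)) + Polynomial.smult (alpha n) (opoly (Suc n))
     + Polynomial.smult (beta n) (opoly n)"
  by (simp add: opoly.simps(3) alpha_def beta_def hn_def)

lemma opoly_Suc_Suc:
  "opoly (Suc (Suc n)) = X * opoly (Suc n) - Polynomial.smult (alpha n) (opoly (Suc n))
     - Polynomial.smult (beta n) (opoly n)"
  by (simp add: three_term)

lemma beta_0 [simp]: "beta 0 = 0"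
  by (simp add: beta_def)

lemma beta_Suc: "beta (Suc n) = hn (Suc n) / hn n"
  by (simp add: beta_def hn_def)

lemma degree_opoly_le: "degree (opoly (Suc n)) \<le> n \<and> degree (opoly n) \<le> n"
proof (induction n)
  case 0
  show ?case by simp
next
  case (Suc n)
  have "degree (X * opoly (Suc n)) \<le> Suc n"
    using Suc degree_X_mult_le by blast
  moreover have "degree (Polynomial.smult (alpha n) (opoly (Suc n))) \<le> Suc n"
    using Suc degree_smult_le[of "alpha n" "opoly (Suc n)"] by linarith
  moreover have "degree (Polynomial.smult (beta n) (opoly n)) \<le> Suc n"
    using Suc degree_smult_le[of "beta n" "opoly n"] by linarith
  ultimately have "degree (opoly (Suc (Suc n))) \<le> Suc n"
    unfolding opoly_Suc_Suc by (intro degree_diff_le) auto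
  then show ?case using Suc by simp
qed

lemma degree_opoly_Suc_le: "degree (opoly (Suc n)) \<le> n"
  using degree_opoly_le by blast

lemma degree_opoly_lt: "degree (opoly n) \<le> n - 1"
  by (cases n) (auto simp: degree_opoly_Suc_le)

lemma coeff_opoly_eq_0: "n \<le> i \<Longrightarrow> coeff (opoly n) i = 0"
  using degree_opoly_lt[of n] by (cases n) (auto intro: coeff_eq_0)

lemma lead_opoly [simp]: "coeff (opoly (Suc n)) n = 1"
proof (induction n)
  case (Suc n)
  then show ?case
    by (simp add: opoly_Suc_Suc coeff_X_mult coeff_opoly_eq_0)
qed simp

lemma opoly_nonzero [simp]: "opoly (Suc n) \<noteq> 0"
  using lead_opoly[of n] by force

lemma hn_pos: "hn n > 0"
  unfolding hn_def by (rule pos) simp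

lemma beta_pos: "beta (Suc n) > 0"
  by (simp add: beta_Suc hn_pos)

lemma hn_Suc_eq: "hn (Suc n) = beta (Suc n) * hn n"
  using hn_pos[of n] by (simp add: beta_Suc)

text \<open>Move \<open>X\<close> from the higher polynomial onto the lower one and apply the
  recurrence again. By induction only pairings of a polynomial with itself survive, and
  \<open>alpha\<close>, \<open>beta\<close> are chosen to cancel them.\<close>

lemma orthogonal: "i < n \<Longrightarrow> L (opoly i * opoly n) = 0"
proof (induction n arbitrary: i rule: less_induct)
  case (less n)
  consider "n = 0" | "n = 1" | m where "n = Suc (Suc m)"
    by (metis One_nat_def not0_implies_Suc)
  then show ?case
  proof cases
    case 3
    have split: "L (opoly i * opoly n) = L (X * opoly i * opoly (Suc m))
        - alpha m * L (opoly i * opoly (Suc m)) - beta m * L (opoly i * opoly m)"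
      unfolding 3 opoly_Suc_Suc
      by (simp add: algebra_simps diff add smult)
    consider "i = 0" | "i = Suc m" | j where "i = Suc j" "j < m"
      using less.prems 3 by (metis less_Suc_eq not0_implies_Suc Suc_less_eq)
    then show ?thesis
    proof cases
      case 1
      then show ?thesis by simp
    next
      case 2
      have "L (opoly (Suc m) * opoly m) = 0"
        using less.IH[of "Suc m" m] 3 by (simp add: mult.commute)
      then show ?thesis
        using hn_pos[of m] unfolding split unfolding 2 by (simp add: alpha_def hn_def[symmetric])
    next
      case (3 j)
      have IH: "L (opoly k * opoly (Suc m)) = 0" if "k \<le> m" for k
        using less.IH[of "Suc m" k] that \<open>n = Suc (Suc m)\<close> by simp
      have "L (X * opoly i * opoly (Suc m)) = L (opoly (Suc (Suc j)) * opoly (Suc m))"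
        unfolding \<open>i = Suc j\<close> three_term using IH[of "Suc j"] IH[of j] 3
        by (simp add: distrib_right add smult)
      \<comment> \<open>Non-zero only for \<open>Suc j = m\<close>; there it is
        \<open>hn m = beta m * hn j\<close>, which cancels the \<open>beta m\<close> term.\<close>
      moreover have "L (opoly (Suc (Suc j)) * opoly (Suc m)) = beta m * L (opoly i * opoly m)"
      proof (cases "Suc j = m")
        case True
        then show ?thesis using hn_Suc_eq[of j] 3
          by (auto simp: hn_def)
      next
        case False
        then have "L (opoly i * opoly m) = 0" 
          using less.IH[of m i] 3 \<open>n = Suc (Suc m)\<close> by simp
        then show ?thesis using False 3 IH[of "Suc (Suc j)"] by simp
      qed
      ultimately show ?thesis
        using IH[of i] 3 unfolding split by simp
    qed
  qed (use less.prems in auto)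
qed

text \<open>Subtracting \<open>coeff q n\<close> times the monic \<open>opoly (Suc n)\<close> lowers
  the degree below \<open>n\<close>; peeling off leading terms then leaves only pairings with
  earlier orthogonal polynomials.\<close>

lemma L_opoly_mult:
  assumes "degree q \<le> n"
  shows "L (opoly (Suc n) * q) = coeff q n * hn n"
proof -
  have *: "degree q \<le> m \<Longrightarrow> m < n \<Longrightarrow> L (opoly (Suc n) * q) = 0" for q m
  proof (induction m arbitrary: q)
    case 0
    then have "q = Polynomial.smult (coeff q 0) (opoly (Suc 0))"
      by (auto simp: degree_eq_zeroE elim!: degree_eq_zeroE)
    then have "L (opoly (Suc n) * q) = coeff q 0 * L (opoly (Suc 0) * opoly (Suc n))"
      by (metis mult.commute mult_smult_right smult)
    then show ?case using orthogonal[of "Suc 0" "Suc n"] 0 by simp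
  next
    case (Suc m)
    define r where "r = q - Polynomial.smult (coeff q (Suc m)) (opoly (Suc (Suc m)))"
    have "degree r \<le> Suc m"
      unfolding r_def using Suc.prems degree_opoly_Suc_le[of "Suc m"]
      by (intro degree_diff_le) (auto intro: order.trans[OF degree_smult_le])
    moreover have "coeff r (Suc m) = 0" by (simp add: r_def)
    ultimately have "degree r \<le> m"
      by (metis le_SucE degree_0 le0 leading_coeff_0_iff)
    then have "L (opoly (Suc n) * r) = 0" using Suc by simp
    moreover have "L (opoly (Suc n) * opoly (Suc (Suc m))) = 0"
      using orthogonal[of "Suc (Suc m)" "Suc n"] Suc by (simp add: mult.commute)
    ultimately show ?case
      by (simp add: r_def right_diff_distrib diff smult)
  qed
  define r where "r = q - Polynomial.smult (coeff q n) (opoly (Suc n))"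
  have "degree r \<le> n"
    unfolding r_def using assms degree_opoly_Suc_le[of n]
    by (intro degree_diff_le) (auto intro: order.trans[OF degree_smult_le])
  moreover have "coeff r n = 0" by (simp add: r_def)
  ultimately have "r = 0 \<or> degree r < n"
    by (metis le_neq_implies_less leading_coeff_0_iff)
  then have "L (opoly (Suc n) * r) = 0" using * by auto
  then show ?thesis
    by (simp add: r_def right_diff_distrib diff smult hn_def)
qed

lemma L_opoly_mult_lt: "degree q < n \<Longrightarrow> L (opoly (Suc n) * q) = 0"
  using L_opoly_mult[of q n] by (simp add: coeff_eq_0)

lemma L_X_opoly_opoly: "L (X * opoly (Suc n) * opoly (Suc n)) = alpha n * hn n"
  using hn_pos[of n] by (simp add: alpha_def)

lemma L_X_opoly_prev: "L (X * opoly (Suc n) * opoly n) = beta n * L (opoly n * opoly n)"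
proof -
  have "L (X * opoly (Suc n) * opoly n) = L (opoly n * opoly (Suc (Suc n)))
      + alpha n * L (opoly n * opoly (Suc n)) + beta n * L (opoly n * opoly n)"
    by (simp add: three_term distrib_right distrib_left add smult mult.commute)
  then show ?thesis by (simp add: orthogonal)
qed

text \<open>Clears the denominator of \<open>beta\<close>; index 0 is separate because
  \<open>beta 0 = 0\<close> while \<open>hn 0 > 0\<close>.\<close>

lemma beta_hn: "beta n * L (opoly n * opoly n) = (if n = 0 then 0 else hn n)"
  using hn_pos[of "n - 1"] by (cases n) (auto simp: beta_Suc hn_def)

text \<open>Expand one factor \<open>X * opoly (Suc n)\<close> by the recurrence: its three
  components contribute \<open>beta (Suc n)\<close>, the square of \<open>alpha n\<close>, and
  \<open>beta n\<close>.\<close>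

lemma L_XX_opoly_opoly:
  "L (X * opoly (Suc n) * (X * opoly (Suc n))) = (beta (Suc n) + (alpha n)\<^sup>2 + beta n) * hn n"
proof -
  have "L (X * opoly (Suc n) * (X * opoly (Suc n))) =
      L (opoly (Suc (Suc n)) * (X * opoly (Suc n)))
      + alpha n * L (X * opoly (Suc n) * opoly (Suc n)) + beta n * L (X * opoly (Suc n) * opoly n)"
    by (subst three_term) (simp add: algebra_simps add smult)
  moreover have "L (opoly (Suc (Suc n)) * (X * opoly (Suc n))) = hn (Suc n)"
    using L_opoly_mult[OF degree_X_mult_le[OF degree_opoly_Suc_le[of n]]]
    by (simp add: coeff_X_mult)
  moreover have "beta n * L (X * opoly (Suc n) * opoly n) = beta n * hn n"
    by (simp add: L_X_opoly_prev beta_hn)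
  ultimately show ?thesis
    unfolding L_X_opoly_opoly hn_Suc_eq by (simp add: power2_eq_square algebra_simps)
qed

text \<open>Each step of the recurrence subtracts one \<open>alpha\<close>; the \<open>beta\<close>
  term has too low a degree. This connects the sum of the \<open>alpha j\<close> with the ladder
  equation.\<close>

lemma coeff_opoly_subleading: "coeff (opoly (Suc (Suc n))) n = - (\<Sum>j\<le>n. alpha j)"
proof (induction n)
  case 0
  then show ?case by (simp add: opoly_Suc_Suc coeff_X)
next
  case (Suc n)
  then show ?case
    by (simp add: opoly_Suc_Suc[of "Suc n"] coeff_X_mult coeff_opoly_eq_0)
qed

text \<open>Since \<open>beta\<close> is positive from index 1 on, a common root would descend
  through the recurrence to the constant \<open>opoly (Suc 0) = 1\<close>.\<close>

lemma opoly_no_common_root: "poly (opoly (Suc n)) x \<noteq> 0 \<or> poly (opoly n) x \<noteq> 0"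
proof (induction n)
  case (Suc n)
  then show ?case
    using beta_pos[of "n - 1"] by (cases n) (auto simp: opoly_Suc_Suc)
qed simp

end

section \<open>Functionals with a Pearson relation: ladder and Freud equations\<close>

text \<open>The relation says that \<open>(x * p * w)'\<close> integrates to zero for a weight with
  \<open>x * w' = (\<gamma> - 2 * x\<^sup>2 - t * x) * w\<close>.\<close>

locale pearson_functional = positive_functional +
  fixes \<gamma> t :: real
  assumes pearson: "L (p + X * pderiv p + Polynomial.smult \<gamma> p
      - Polynomial.smult 2 (X * X * p) - Polynomial.smult t (X * p)) = 0"
begin

lemma pearson_mult:
  "L (p * q) + L (X * pderiv p * q) + L (p * (X * pderiv q)) + \<gamma> * L (p * q)
     - 2 * L (X * p * (X * q)) - t * L (p * (X * q)) = 0"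
proof -
  have "p * q + X * pderiv (p * q) + Polynomial.smult \<gamma> (p * q) - Polynomial.smult 2 (X * X * (p * q))
      - Polynomial.smult t (X * (p * q))
    = p * q + X * pderiv p * q + p * (X * pderiv q) + Polynomial.smult \<gamma> (p * q)
      - Polynomial.smult 2 (X * p * (X * q)) - Polynomial.smult t (p * (X * q))"
    by (simp add: pderiv_mult algebra_simps)
  then show ?thesis using pearson[of "p * q"] by (simp only: add diff smult)
qed

text \<open>The difference \<open>R\<close> of the two sides has degree below \<open>n\<close>, and
  the Pearson relation with the three-term recurrence makes it orthogonal to every such polynomial,
  hence to itself; positivity forces \<open>R = 0\<close>.\<close>

lemma ladder:
  "X * pderiv (opoly (Suc n)) = Polynomial.smult (real n - 2 * beta n) (opoly (Suc n))
     + Polynomial.smult (beta n)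
         (Polynomial.smult 2 (X * opoly n) + Polynomial.smult (2 * alpha n + t) (opoly n))"
proof (cases n)
  case 0
  then show ?thesis by simp
next
  case (Suc m)
  let ?p = "opoly (Suc n)" and ?q = "opoly n"
  define R where "R = X * pderiv ?p - Polynomial.smult (real n - 2 * beta n) ?p
     - Polynomial.smult (beta n) (Polynomial.smult 2 (X * ?q) + Polynomial.smult (2 * alpha n + t) ?q)"
  have dq: "degree ?q \<le> m" using Suc degree_opoly_Suc_le[of m] by simp
  have LR: "L (R * r) = 0" if r: "degree r < n" for r
  proof -
    have rm: "degree r \<le> m" using r Suc by simp
    have pr: "L (?p * r) = 0" using L_opoly_mult_lt[OF r] .
    have "degree (X * pderiv r) < n"
    proof (cases "degree r = 0")
      case True
      then show ?thesis using Suc by (auto elim!: degree_eq_zeroE simp: pderiv_pCons)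
    next
      case False
      then show ?thesis using degree_X_mult_le[of "pderiv r" "degree r - 1"] r
        by (auto simp: degree_pderiv)
    qed
    then have pdr: "L (?p * (X * pderiv r)) = 0" by (rule L_opoly_mult_lt)
    have pXr: "L (?p * (X * r)) = coeff r m * hn n"
      using L_opoly_mult[OF degree_X_mult_le[OF rm]] Suc by (simp add: coeff_X_mult)
    have qr: "L (?q * r) = coeff r m * hn m"
      using L_opoly_mult[OF rm] Suc by simp
    have "L (X * ?p * (X * r)) = L (opoly (Suc (Suc n)) * (X * r)) + alpha n * L (?p * (X * r))
        + beta n * L (?q * (X * r))"
      by (subst three_term) (simp add: distrib_right add smult)
    moreover have "L (opoly (Suc (Suc n)) * (X * r)) = 0"
      using degree_X_mult_le[OF rm] Suc by (intro L_opoly_mult_lt) simp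
    ultimately have XX: "L (X * ?p * (X * r)) = alpha n * L (?p * (X * r)) + beta n * L (?q * (X * r))"
      by simp
    have "L (?p * r) + L (X * pderiv ?p * r) + L (?p * (X * pderiv r)) + \<gamma> * L (?p * r)
        - 2 * L (X * ?p * (X * r)) - t * L (?p * (X * r)) = 0"
      by (rule pearson_mult)
    \<comment> \<open>Orthogonality removes every term pairing \<open>?p\<close> with a polynomial
      of degree below \<open>n\<close>.\<close>
    then have "L (X * pderiv ?p * r) = 2 * L (X * ?p * (X * r)) + t * L (?p * (X * r))"
      using pr pdr by simp
    \<comment> \<open>Turns \<open>L (?p * (X * r))\<close> into \<open>beta n * L (?q * r)\<close>,
      the source of the term \<open>2 * alpha n + t\<close>.\<close>
    moreover have "beta n * hn m = hn n" using hn_Suc_eq[of m] Suc by simp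
    moreover have "L (R * r) = L (X * pderiv ?p * r) - (real n - 2 * beta n) * L (?p * r)
        - beta n * (2 * L (?q * (X * r)) + (2 * alpha n + t) * L (?q * r))"
      unfolding R_def by (simp add: algebra_simps diff add smult)
    ultimately show ?thesis
      using XX pr pXr qr by (simp add: algebra_simps)
  qed
  have "degree (X * pderiv ?p) \<le> n"
    using degree_X_mult_le[of "pderiv ?p" m] degree_opoly_Suc_le[of n] Suc
    by (simp add: degree_pderiv)
  moreover have "degree (X * ?q) \<le> n" using degree_X_mult_le[OF dq] Suc by simp
  ultimately have "degree R \<le> n" unfolding R_def
    using degree_opoly_Suc_le[of n] dq Suc
    by (intro degree_diff_le degree_add_le order.trans[OF degree_smult_le]) auto
  \<comment> \<open>The top coefficients cancel: \<open>real n\<close> on the left,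
    \<open>real n - 2 * beta n\<close> plus \<open>2 * beta n\<close> on the right.\<close>
  moreover have "coeff R n = 0"
    using Suc unfolding R_def
    by (simp add: coeff_X_mult coeff_pderiv coeff_opoly_eq_0)
  ultimately have "R = 0 \<or> degree R < n"
    by (metis le_neq_implies_less leading_coeff_0_iff)
  then have "L (R * R) = 0" using LR by auto
  then have "R = 0" using pos[of R] by force
  then show ?thesis by (simp add: R_def)
qed

text \<open>The Pearson relation with both factors equal to \<open>opoly (Suc n)\<close>; in
  \<open>L (?p * (X * pderiv ?p))\<close> only the leading coefficient \<open>real n\<close>
  matters.\<close>

lemma freud_sum:
  "2 * beta (Suc n) + 2 * beta n + alpha n * (2 * alpha n + t) = 2 * real n + 1 + \<gamma>"
proof -
  let ?p = "opoly (Suc n)"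
  have "degree (X * pderiv ?p) \<le> n"
  proof (cases n)
    case (Suc m)
    then show ?thesis
      using degree_X_mult_le[of "pderiv ?p" m] degree_opoly_Suc_le[of n]
      by (simp add: degree_pderiv)
  qed simp
  then have "L (?p * (X * pderiv ?p)) = real n * hn n"
    by (subst L_opoly_mult) (auto simp: coeff_X_mult coeff_pderiv split: nat.splits)
  moreover have "L (?p * ?p) + 2 * L (?p * (X * pderiv ?p)) + \<gamma> * L (?p * ?p)
      - 2 * L (X * ?p * (X * ?p)) - t * L (X * ?p * ?p) = 0"
    using pearson_mult[of ?p ?p] mult.commute[of ?p "X * ?p"] mult.commute[of ?p "X * pderiv ?p"]
    by (simp only:)
  ultimately have "hn n * (1 + 2 * real n + \<gamma> - 2 * (beta (Suc n) + (alpha n)\<^sup>2 + beta n) - t * alpha n) = 0"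
    unfolding L_XX_opoly_opoly L_X_opoly_opoly hn_def[symmetric] by (simp add: algebra_simps)
  then have "1 + 2 * real n + \<gamma> - 2 * (beta (Suc n) + (alpha n)\<^sup>2 + beta n) - t * alpha n = 0"
    using hn_pos[of n] by simp
  then show ?thesis by (simp add: power2_eq_square algebra_simps)
qed

lemma freud_product:
  "beta (Suc n) * (2 * alpha (Suc n) + t) * (2 * alpha n + t) =
     (2 * beta (Suc n) - real (Suc n)) * (2 * beta (Suc n) - real (Suc n) - \<gamma>)"
proof -
  define u v where "u = poly (opoly (Suc (Suc n))) 0" and "v = poly (opoly (Suc n)) 0"
  define w where "w = poly (opoly n) 0"
  have 1: "(real (Suc n) - 2 * beta (Suc n)) * u + beta (Suc n) * (2 * alpha (Suc n) + t) * v = 0"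
    using arg_cong[OF ladder[of "Suc n"], of "\<lambda>p. poly p 0"] by (simp add: u_def v_def mult.assoc)
  have 2: "(real n - 2 * beta n) * v + (2 * alpha n + t) * (beta n * w) = 0"
    using arg_cong[OF ladder[of n], of "\<lambda>p. poly p 0"] by (simp add: v_def w_def algebra_simps)
  have 3: "beta n * w = - u - alpha n * v"
    by (simp add: u_def v_def w_def opoly_Suc_Suc)
  \<comment> \<open>\<open>freud_sum\<close> eliminates \<open>beta n\<close>, so that the second
    equation, like the first, contains no \<open>beta\<close> other than
    \<open>beta (Suc n)\<close>.\<close>
  have b: "2 * beta n = 2 * real n + 1 + \<gamma> - 2 * beta (Suc n) - alpha n * (2 * alpha n + t)"
    using freud_sum[of n] by simp
  have 4: "(2 * beta (Suc n) - real (Suc n) - \<gamma>) * v = (2 * alpha n + t) * u"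
    using 2 unfolding 3 b by (simp add: algebra_simps)
  \<comment> \<open>\<open>?d\<close> is the determinant of the system \<open>1\<close>,
    \<open>4\<close> in \<open>u\<close>, \<open>v\<close>; Cramer's combinations give
    \<open>?d * u = 0\<close> and \<open>?d * v = 0\<close>.\<close>
  let ?d = "beta (Suc n) * (2 * alpha (Suc n) + t) * (2 * alpha n + t) -
     (2 * beta (Suc n) - real (Suc n)) * (2 * beta (Suc n) - real (Suc n) - \<gamma>)"
  have "?d * u = (2 * beta (Suc n) - real (Suc n) - \<gamma>) *
      ((real (Suc n) - 2 * beta (Suc n)) * u + beta (Suc n) * (2 * alpha (Suc n) + t) * v)
      - beta (Suc n) * (2 * alpha (Suc n) + t) *
        ((2 * beta (Suc n) - real (Suc n) - \<gamma>) * v - (2 * alpha n + t) * u)"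
    by (simp only: algebra_simps)
  then have "?d * u = 0" unfolding 1 4 by simp
  moreover have "?d * v = (2 * alpha n + t) *
      ((real (Suc n) - 2 * beta (Suc n)) * u + beta (Suc n) * (2 * alpha (Suc n) + t) * v)
      + (real (Suc n) - 2 * beta (Suc n)) *
        ((2 * beta (Suc n) - real (Suc n) - \<gamma>) * v - (2 * alpha n + t) * u)"
    by (simp only: algebra_simps)
  then have "?d * v = 0" unfolding 1 4 by simp
  moreover have "u \<noteq> 0 \<or> v \<noteq> 0"
    unfolding u_def v_def by (rule opoly_no_common_root)
  ultimately show ?thesis by auto
qed

lemma sum_alpha:
  "(\<Sum>j\<le>n. alpha j) = beta (Suc n) * (2 * alpha (Suc n) + 2 * alpha n + t)"
proof -
  define s where "s = (\<Sum>j\<le>n. alpha j)"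
  have s: "coeff (opoly (Suc (Suc n))) n = - s"
    by (simp add: coeff_opoly_subleading s_def)
  \<comment> \<open>This is the subleading coefficient of \<open>opoly (Suc n)\<close>, whose sum
    stops one term before \<open>s\<close>; for \<open>n = 0\<close> both sides vanish.\<close>
  have Xp: "coeff (X * opoly (Suc n)) n = - s + alpha n"
  proof (cases n)
    case (Suc m)
    then show ?thesis by (simp add: coeff_X_mult coeff_opoly_subleading s_def)
  qed (simp add: X_def s_def)
  have "coeff (X * pderiv (opoly (Suc (Suc n)))) n = - real n * s"
    using s by (cases n) (auto simp: coeff_X_mult coeff_pderiv algebra_simps)
  then have "- real n * s = (real (Suc n) - 2 * beta (Suc n)) * (- s)
     + beta (Suc n) * (2 * (- s + alpha n) + (2 * alpha (Suc n) + t))"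
    using arg_cong[OF ladder[of "Suc n"], of "\<lambda>p. coeff p n"]
    by (simp add: s Xp)
  then show ?thesis unfolding s_def[symmetric] by (simp add: algebra_simps)
qed

end

section \<open>The Toda flow\<close>

definition moment_functional :: "(nat \<Rightarrow> real) \<Rightarrow> real poly \<Rightarrow> real" where
  "moment_functional \<mu> p = (\<Sum>i\<le>degree p. coeff p i * \<mu> i)"

text \<open>One bound \<open>N\<close> lets polynomials of varying degree share a summation
  range.\<close>

lemma moment_functional_eq:
  assumes "degree p \<le> N"
  shows "moment_functional \<mu> p = (\<Sum>i\<le>N. coeff p i * \<mu> i)"
  unfolding moment_functional_def
  by (rule sum.mono_neutral_left) (use assms in \<open>auto simp: coeff_eq_0\<close>)

lemma moment_functional_add:
  "moment_functional \<mu> (p + q) = moment_functional \<mu> p + moment_functional \<mu> q"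
proof -
  let ?N = "max (degree p) (degree q)"
  have "degree (p + q) \<le> ?N" by (rule degree_add_le_max)
  then show ?thesis
    by (simp add: moment_functional_eq[of _ ?N] distrib_right sum.distrib)
qed

lemma moment_functional_smult:
  "moment_functional \<mu> (Polynomial.smult c p) = c * moment_functional \<mu> p"
  using degree_smult_le[of c p]
  by (simp add: moment_functional_eq[of _ "degree p"] sum_distrib_left mult.assoc)

section \<open>Differentiating polynomials in a parameter\<close>

text \<open>Differentiation in the parameter \<open>s\<close>, whereas \<open>pderiv\<close>
  differentiates in the variable of the polynomial.\<close>

definition has_poly_derivative :: "(real \<Rightarrow> real poly) \<Rightarrow> real poly \<Rightarrow> real \<Rightarrow> bool" where
  "has_poly_derivative f f' t \<longleftrightarrow>
     (\<forall>i. ((\<lambda>s. coeff (f s) i) has_real_derivative coeff f' i) (at t))"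

lemma has_poly_derivative_const: "has_poly_derivative (\<lambda>s. p) 0 t"
  by (simp add: has_poly_derivative_def)

lemma has_poly_derivative_diff:
  "has_poly_derivative f f' t \<Longrightarrow> has_poly_derivative g g' t \<Longrightarrow>
   has_poly_derivative (\<lambda>s. f s - g s) (f' - g') t"
  by (auto simp: has_poly_derivative_def intro!: derivative_eq_intros)

lemma has_poly_derivative_smult:
  assumes "(c has_real_derivative c') (at t)" "has_poly_derivative f f' t"
  shows "has_poly_derivative (\<lambda>s. Polynomial.smult (c s) (f s))
           (Polynomial.smult c' (f t) + Polynomial.smult (c t) f') t"
  using assms
  by (auto simp: has_poly_derivative_def intro!: derivative_eq_intros)

lemma has_poly_derivative_mult:
  assumes "has_poly_derivative f f' t" "has_poly_derivative g g' t"
  shows "has_poly_derivative (\<lambda>s. f s * g s) (f' * g t + f t * g') t"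
  unfolding has_poly_derivative_def
proof
  fix i
  have "((\<lambda>s. \<Sum>j\<le>i. coeff (f s) j * coeff (g s) (i - j)) has_real_derivative
      (\<Sum>j\<le>i. coeff f' j * coeff (g t) (i - j) + coeff (f t) j * coeff g' (i - j))) (at t)"
    using assms unfolding has_poly_derivative_def
    by (auto intro!: derivative_eq_intros sum.cong)
  then show "((\<lambda>s. coeff (f s * g s) i) has_real_derivative coeff (f' * g t + f t * g') i) (at t)"
    by (simp add: coeff_mult sum.distrib)
qed

lemma has_poly_derivative_X_mult:
  "has_poly_derivative f f' t \<Longrightarrow> has_poly_derivative (\<lambda>s. X * f s) (X * f') t"
  using has_poly_derivative_mult[OF has_poly_derivative_const, of f f' t X] by simp

lemma degree_has_poly_derivative_le:
  assumes "has_poly_derivative f f' t" "\<And>s. degree (f s) \<le> N"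
  shows "degree f' \<le> N"
proof (rule degree_le, intro allI impI)
  fix i assume "N < i"
  then have "coeff (f s) i = 0" for s using assms(2)[of s] by (simp add: coeff_eq_0)
  moreover have "((\<lambda>s. coeff (f s) i) has_real_derivative coeff f' i) (at t)"
    using assms(1) unfolding has_poly_derivative_def by blast
  ultimately have "((\<lambda>s. 0) has_real_derivative coeff f' i) (at t)" by simp
  then show "coeff f' i = 0"
    by (rule DERIV_unique) (rule DERIV_const)
qed

text \<open>Product rule: the moving coefficients give \<open>f'\<close>, and the moving moments
  give the factor \<open>- X\<close>, since raising the index of a moment is multiplication by
  \<open>X\<close>. The degree bound, uniform in \<open>s\<close>, fixes the number of
  summands.\<close>

lemma moment_functional_has_derivative:
  assumes \<mu>: "\<And>k. ((\<lambda>s. \<mu> s k) has_real_derivative - \<mu> t (Suc k)) (at t)"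
    and f: "has_poly_derivative f f' t" and deg: "\<And>s. degree (f s) \<le> N"
  shows "((\<lambda>s. moment_functional (\<mu> s) (f s)) has_real_derivative
      moment_functional (\<mu> t) f' - moment_functional (\<mu> t) (X * f t)) (at t)"
proof -
  have "((\<lambda>s. \<Sum>i\<le>N. coeff (f s) i * \<mu> s i) has_real_derivative
      (\<Sum>i\<le>N. coeff f' i * \<mu> t i - coeff (f t) i * \<mu> t (Suc i))) (at t)"
    using \<mu> f unfolding has_poly_derivative_def
    by (auto intro!: derivative_eq_intros sum.cong)
  moreover have "moment_functional (\<mu> t) (X * f t) = (\<Sum>i\<le>N. coeff (f t) i * \<mu> t (Suc i))"
    using deg[of t] unfolding moment_functional_eq[OF degree_X_mult_le[OF deg]]
    by (subst sum.atMost_Suc_shift) (simp add: coeff_X_mult)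
  ultimately show ?thesis
    using moment_functional_eq[OF deg] moment_functional_eq[OF degree_has_poly_derivative_le[OF f deg]]
    by (simp add: sum_subtractf)
qed

section \<open>Recurrence coefficients along the Toda flow\<close>

locale toda_flow =
  fixes \<mu> :: "real \<Rightarrow> nat \<Rightarrow> real" and \<gamma> :: real
  assumes moment_deriv: "((\<lambda>s. \<mu> s k) has_real_derivative - \<mu> t (Suc k)) (at t)"
    and functional: "pearson_functional (moment_functional (\<mu> t)) \<gamma> t"
begin

sublocale F: pearson_functional "moment_functional (\<mu> t)" \<gamma> t for t
  by (rule functional)

abbreviation "M \<equiv> \<lambda>t. moment_functional (\<mu> t)"

text \<open>The velocity of the polynomial is orthogonal to it, so only the factor
  \<open>- X\<close> contributes. The velocity is a hypothesis, here and for \<open>alpha\<close>,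
  because \<open>opoly_deriv\<close> uses these lemmas within its own induction.\<close>

lemma hn_deriv_aux:
  assumes "has_poly_derivative (\<lambda>s. F.opoly s (Suc n)) (Polynomial.smult (F.beta t n) (F.opoly t n)) t"
  shows "((\<lambda>s. F.hn s n) has_real_derivative - F.alpha t n * F.hn t n) (at t)"
proof -
  let ?p = "F.opoly t (Suc n)" and ?q = "F.opoly t n"
  have "((\<lambda>s. M s (F.opoly s (Suc n) * F.opoly s (Suc n))) has_real_derivative
     M t (Polynomial.smult (F.beta t n) ?q * ?p + ?p * Polynomial.smult (F.beta t n) ?q) - M t (X * (?p * ?p))) (at t)"
  proof (rule moment_functional_has_derivative[where \<mu> = \<mu>, OF moment_deriv])
    show "has_poly_derivative (\<lambda>s. F.opoly s (Suc n) * F.opoly s (Suc n))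
       (Polynomial.smult (F.beta t n) ?q * ?p + ?p * Polynomial.smult (F.beta t n) ?q) t"
      by (intro has_poly_derivative_mult assms)
    show "degree (F.opoly s (Suc n) * F.opoly s (Suc n)) \<le> n + n" for s
      using F.degree_opoly_Suc_le[of s n] degree_mult_le[of "F.opoly s (Suc n)" "F.opoly s (Suc n)"]
      by linarith
  qed
  moreover have "M t (X * (?p * ?p)) = F.alpha t n * F.hn t n"
    using F.L_X_opoly_opoly[of t n] by (simp add: mult.assoc)
  moreover have "M t (Polynomial.smult (F.beta t n) ?q * ?p + ?p * Polynomial.smult (F.beta t n) ?q) = 0"
    using F.orthogonal[of n "Suc n" t] by (simp only: F.add F.smult mult_smult_left mult_smult_right
        mult.commute[of ?p ?q])
  ultimately show ?thesis by (simp add: F.hn_def)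
qed

text \<open>Quotient rule. After division by \<open>hn t n\<close> the numerator gives
  \<open>2 * beta\<close> from the velocity minus the squared norm of
  \<open>X * opoly (Suc n)\<close>; the square of \<open>alpha\<close> in that norm cancels against
  the derivative of \<open>hn\<close>.\<close>

lemma alpha_deriv_aux:
  assumes "has_poly_derivative (\<lambda>s. F.opoly s (Suc n)) (Polynomial.smult (F.beta t n) (F.opoly t n)) t"
  shows "((\<lambda>s. F.alpha s n) has_real_derivative F.beta t n - F.beta t (Suc n)) (at t)"
proof -
  let ?p = "F.opoly t (Suc n)" and ?q = "F.opoly t n"
  have "((\<lambda>s. M s (X * F.opoly s (Suc n) * F.opoly s (Suc n))) has_real_derivative
     M t ((X * Polynomial.smult (F.beta t n) ?q) * ?p + (X * ?p) * Polynomial.smult (F.beta t n) ?q)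
     - M t (X * (X * ?p * ?p))) (at t)"
  proof (rule moment_functional_has_derivative[where \<mu> = \<mu>, OF moment_deriv])
    show "has_poly_derivative (\<lambda>s. X * F.opoly s (Suc n) * F.opoly s (Suc n))
       ((X * Polynomial.smult (F.beta t n) ?q) * ?p + (X * ?p) * Polynomial.smult (F.beta t n) ?q) t"
      by (intro has_poly_derivative_mult has_poly_derivative_X_mult assms)
    show "degree (X * F.opoly s (Suc n) * F.opoly s (Suc n)) \<le> Suc n + n" for s
      using F.degree_opoly_Suc_le[of s n] degree_mult_le[of "X * F.opoly s (Suc n)" "F.opoly s (Suc n)"]
        degree_X_mult_le[OF F.degree_opoly_Suc_le[of s n]]
      by linarith
  qed
  moreover have "M t (X * (X * ?p * ?p)) = (F.beta t (Suc n) + (F.alpha t n)\<^sup>2 + F.beta t n) * F.hn t n"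
    using F.L_XX_opoly_opoly[of t n] by (simp add: mult_ac)
  moreover have "M t ((X * Polynomial.smult (F.beta t n) ?q) * ?p + (X * ?p) * Polynomial.smult (F.beta t n) ?q)
      = F.beta t n * (2 * M t (X * ?p * ?q))"
  proof -
    have "(X * Polynomial.smult (F.beta t n) ?q) * ?p = Polynomial.smult (F.beta t n) (X * ?p * ?q)"
      by (simp add: mult_ac)
    then show ?thesis by (simp only: F.add F.smult mult_smult_right)
  qed
  moreover have "F.beta t n * (2 * M t (X * ?p * ?q)) = 2 * F.beta t n * F.hn t n"
    by (simp add: F.L_X_opoly_prev F.beta_hn)
  ultimately have "((\<lambda>s. M s (X * F.opoly s (Suc n) * F.opoly s (Suc n))) has_real_derivative
     2 * F.beta t n * F.hn t n - (F.beta t (Suc n) + (F.alpha t n)\<^sup>2 + F.beta t n) * F.hn t n) (at t)"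
    by (simp only:)
  from DERIV_divide[OF this hn_deriv_aux[OF assms]]
  have "((\<lambda>s. F.alpha s n) has_real_derivative
     ((2 * F.beta t n * F.hn t n - (F.beta t (Suc n) + (F.alpha t n)\<^sup>2 + F.beta t n) * F.hn t n) * F.hn t n
      - F.alpha t n * F.hn t n * (- F.alpha t n * F.hn t n)) / (F.hn t n * F.hn t n)) (at t)"
    using less_imp_neq[OF F.hn_pos, symmetric] unfolding F.L_X_opoly_opoly by simp
  then show ?thesis
    by (rule DERIV_cong) (use F.hn_pos[of t n] in \<open>simp add: field_simps power2_eq_square\<close>)
qed

text \<open>Quotient rule for \<open>hn n / hn (n - 1)\<close>. At \<open>n = 0\<close> the
  coefficient \<open>beta\<close> is identically 0, so the truncated \<open>n - 1\<close> is
  harmless.\<close>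

lemma beta_deriv_aux:
  assumes "\<And>k. k \<le> n \<Longrightarrow> ((\<lambda>s. F.hn s k) has_real_derivative - F.alpha t k * F.hn t k) (at t)"
  shows "((\<lambda>s. F.beta s n) has_real_derivative - F.beta t n * (F.alpha t n - F.alpha t (n - 1))) (at t)"
proof (cases n)
  case (Suc m)
  have "F.hn t m \<noteq> 0" using F.hn_pos[of t m] by simp
  moreover have "((\<lambda>s. F.hn s (Suc m)) has_real_derivative - F.alpha t (Suc m) * F.hn t (Suc m)) (at t)"
    "((\<lambda>s. F.hn s m) has_real_derivative - F.alpha t m * F.hn t m) (at t)"
    using assms Suc by auto
  ultimately show ?thesis
    unfolding Suc F.beta_Suc by (auto intro!: derivative_eq_intros simp: field_simps)
qed simp

text \<open>The orthogonal polynomial of degree \<open>n\<close> moves with velocity \<open>beta n\<close> times the previous one,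
  because differentiating an orthogonality relation only produces the factor \<open>- X\<close>.\<close>

lemma opoly_deriv:
  "has_poly_derivative (\<lambda>s. F.opoly s (Suc n)) (Polynomial.smult (F.beta t n) (F.opoly t n)) t"
proof (induction n rule: less_induct)
  case (less k)
  show ?case
  proof (cases k)
    case 0
    then show ?thesis by (simp add: has_poly_derivative_const)
  next
    case (Suc n)
    have C: "has_poly_derivative (\<lambda>s. F.opoly s (Suc j)) (Polynomial.smult (F.beta t j) (F.opoly t j)) t"
      if "j \<le> n" for j
      using less Suc that by simp
    \<comment> \<open>For \<open>n = 0\<close> the truncated index is harmless since
      \<open>opoly 0 = 0\<close>.\<close>
    have C': "has_poly_derivative (\<lambda>s. F.opoly s n)
        (Polynomial.smult (F.beta t (n - 1)) (F.opoly t (n - 1))) t"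
      by (cases n) (use C[of "n - 1"] in \<open>auto simp: has_poly_derivative_const\<close>)
    have "has_poly_derivative (\<lambda>s. F.opoly s (Suc (Suc n)))
      (X * Polynomial.smult (F.beta t n) (F.opoly t n)
       - (Polynomial.smult (F.beta t n - F.beta t (Suc n)) (F.opoly t (Suc n))
          + Polynomial.smult (F.alpha t n) (Polynomial.smult (F.beta t n) (F.opoly t n)))
       - (Polynomial.smult (- F.beta t n * (F.alpha t n - F.alpha t (n - 1))) (F.opoly t n)
          + Polynomial.smult (F.beta t n)
              (Polynomial.smult (F.beta t (n - 1)) (F.opoly t (n - 1))))) t"
      unfolding F.opoly_Suc_Suc
      using C C' by (intro has_poly_derivative_diff has_poly_derivative_X_mult
          has_poly_derivative_smult alpha_deriv_aux beta_deriv_aux hn_deriv_aux) auto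
    also have "X * Polynomial.smult (F.beta t n) (F.opoly t n)
       - (Polynomial.smult (F.beta t n - F.beta t (Suc n)) (F.opoly t (Suc n))
          + Polynomial.smult (F.alpha t n) (Polynomial.smult (F.beta t n) (F.opoly t n)))
       - (Polynomial.smult (- F.beta t n * (F.alpha t n - F.alpha t (n - 1))) (F.opoly t n)
          + Polynomial.smult (F.beta t n)
              (Polynomial.smult (F.beta t (n - 1)) (F.opoly t (n - 1))))
       = Polynomial.smult (F.beta t (Suc n)) (F.opoly t (Suc n))" (is "?lhs = ?rhs")
    proof (cases n)
      case 0
      then show ?thesis by (simp add: poly_eq_iff)
    next
      case (Suc m)
      show ?thesis
      proof (rule poly_eqI)
        fix i
        \<comment> \<open>After factoring out \<open>beta n\<close>, the recurrence at
          \<open>m\<close> cancels everything except \<open>beta (Suc n)\<close> times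
          \<open>opoly (Suc n)\<close>.\<close>
        have "coeff (X * F.opoly t (Suc m)) i = coeff (F.opoly t (Suc (Suc m))) i
           + F.alpha t m * coeff (F.opoly t (Suc m)) i + F.beta t m * coeff (F.opoly t m) i"
          by (simp add: F.three_term)
        then show "coeff ?lhs i = coeff ?rhs i"
          unfolding Suc by (simp add: F.opoly_Suc_Suc[of t m] algebra_simps)
      qed
    qed
    finally show ?thesis using Suc by simp
  qed
qed

lemmas hn_deriv = hn_deriv_aux[OF opoly_deriv]
lemmas alpha_deriv = alpha_deriv_aux[OF opoly_deriv]
lemmas beta_deriv = beta_deriv_aux[OF hn_deriv]

definition sig :: "nat \<Rightarrow> real \<Rightarrow> real" where
  "sig n t = - (\<Sum>j<n. F.alpha t j)"

lemma ln_prod_hn_deriv: "((\<lambda>s. ln (\<Prod>j<n. F.hn s j)) has_real_derivative sig n t) (at t)"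
proof -
  have "((\<lambda>s. \<Sum>j<n. ln (F.hn s j)) has_real_derivative sig n t) (at t)"
    unfolding sig_def sum_negf[symmetric]
  proof (rule DERIV_sum)
    fix j
    show "((\<lambda>s. ln (F.hn s j)) has_real_derivative - F.alpha t j) (at t)"
      using DERIV_ln_divide[OF F.hn_pos[of t j]] hn_deriv[of j t] F.hn_pos[of t j]
      by (auto intro!: derivative_eq_intros)
  qed
  moreover have "(\<lambda>s. ln (\<Prod>j<n. F.hn s j)) = (\<lambda>s. \<Sum>j<n. ln (F.hn s j))"
    by (subst ln_prod) (auto simp: F.hn_pos less_imp_neq[symmetric])
  ultimately show ?thesis by simp
qed

text \<open>The sum of the derivatives of \<open>alpha\<close> telescopes, with lower end
  \<open>beta t 0 = 0\<close>.\<close>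

lemma sig_deriv: "(sig n has_real_derivative F.beta t n) (at t)"
proof -
  have "((\<lambda>s. - (\<Sum>j<n. F.alpha s j)) has_real_derivative
      - (\<Sum>j<n. F.beta t j - F.beta t (Suc j))) (at t)"
    by (intro DERIV_minus DERIV_sum alpha_deriv)
  moreover have "(\<Sum>j<n. F.beta t j - F.beta t (Suc j)) = - F.beta t n"
    by (induction n) auto
  ultimately show ?thesis unfolding sig_def[abs_def] by simp
qed

text \<open>With \<open>b\<close>, \<open>a1\<close>, \<open>a0\<close> as in the proof,
  \<open>t * b - sig n t = 2 * b * (a1 + a0 + t)\<close>, and the cubic term is
  \<open>b\<^sup>2 * (2 * a1 + t) * (2 * a0 + t)\<close>. A quarter of the square of the former
  minus the latter is \<open>b\<^sup>2 * (a1 - a0)\<^sup>2\<close>. For \<open>n = 0\<close> every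
  term vanishes.\<close>

lemma sigma_form:
  "(- F.beta t n * (F.alpha t n - F.alpha t (n - 1)))\<^sup>2 =
     1 / 4 * (t * F.beta t n - sig n t)\<^sup>2
     - 4 * (F.beta t n - real n / 2) * F.beta t n * (F.beta t n - (real n + \<gamma>) / 2)"
proof (cases n)
  case (Suc m)
  define b a1 a0 where "b = F.beta t n" and "a1 = F.alpha t n" and "a0 = F.alpha t m"
  have s: "sig n t = - b * (2 * a1 + 2 * a0 + t)"
    using F.sum_alpha[of t m] by (simp add: sig_def Suc b_def a1_def a0_def lessThan_Suc_atMost)
  have f: "b * (2 * a1 + t) * (2 * a0 + t) = (2 * b - real n) * (2 * b - real n - \<gamma>)"
    using F.freud_product[of t m] by (simp add: Suc b_def a1_def a0_def)
  have "4 * (b - real n / 2) * b * (b - (real n + \<gamma>) / 2) = b * ((2 * b - real n) * (2 * b - real n - \<gamma>))"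
    by (simp add: field_simps)
  then have g: "4 * (b - real n / 2) * b * (b - (real n + \<gamma>) / 2) = b * (b * (2 * a1 + t) * (2 * a0 + t))"
    by (simp only: f)
  have "(- b * (a1 - a0))\<^sup>2 = 1 / 4 * (t * b - sig n t)\<^sup>2
     - 4 * (b - real n / 2) * b * (b - (real n + \<gamma>) / 2)"
    unfolding g s by (simp add: field_simps power2_eq_square)
  then show ?thesis by (simp add: b_def a1_def a0_def Suc)
qed (simp add: sig_def)

end

section \<open>Hankel determinants\<close>

lemma moment_functional_monom: "moment_functional \<nu> (Polynomial.monom c k) = c * \<nu> k"
  using degree_monom_le[of c k]
  by (subst moment_functional_eq[of _ k]) (auto simp: if_distrib[of "\<lambda>x. x * _"] cong: if_cong)

text \<open>A Gram matrix under change of basis: the coefficient matrix \<open>U\<close> is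
  unitriangular, so it has determinant 1, and \<open>U * H * transpose_mat U\<close> is the diagonal
  matrix of squared norms.\<close>

lemma det_hankel_orthogonal:
  fixes Q :: "nat \<Rightarrow> real poly" and h :: "nat \<Rightarrow> real"
  assumes deg: "\<And>i. degree (Q i) \<le> i" and monic: "\<And>i. coeff (Q i) i = 1"
    and orth: "\<And>i j. moment_functional \<nu> (Q i * Q j) = (if i = j then h i else 0)"
  shows "Determinant.det (Matrix.mat n n (\<lambda>(i, j). \<nu> (i + j))) = (\<Prod>i<n. h i)"
proof -
  define H where "H = Matrix.mat n n (\<lambda>(i, j). \<nu> (i + j))"
  define U where "U = Matrix.mat n n (\<lambda>(i, j). coeff (Q i) j)"
  define E where "E = Matrix.mat n n (\<lambda>(i, j). if i = j then h i else 0)"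
  have carr: "H \<in> carrier_mat n n" "U \<in> carrier_mat n n" "E \<in> carrier_mat n n"
    by (simp_all add: H_def U_def E_def)
  have detU: "Determinant.det U = 1"
  proof -
    have "Determinant.det U = prod_list (diag_mat U)"
      using deg by (intro det_lower_triangular[OF _ carr(2)])
        (auto simp: U_def intro!: coeff_eq_0 intro: le_less_trans)
    then show ?thesis by (simp add: prod_list_diag_prod U_def monic)
  qed
  have detE: "Determinant.det E = (\<Prod>i<n. h i)"
  proof -
    have "Determinant.det E = prod_list (diag_mat E)"
      by (intro det_lower_triangular[OF _ carr(3)]) (auto simp: E_def)
    then show ?thesis by (simp add: prod_list_diag_prod E_def lessThan_atLeast0)
  qed
  have sum_add: "moment_functional \<nu> (\<Sum>i\<in>I. f i) = (\<Sum>i\<in>I. moment_functional \<nu> (f i))"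
    if "finite I" for f :: "nat \<Rightarrow> real poly" and I
    using that by (induction I rule: finite_induct) (auto simp: moment_functional_add moment_functional_eq[of 0 0])
  have bilinear: "moment_functional \<nu> (p * q) =
      (\<Sum>k = 0..<n. \<Sum>l = 0..<n. coeff p k * \<nu> (k + l) * coeff q l)"
    if "degree p < n" "degree q < n" for p q :: "real poly"
  proof -
    have expand: "r = (\<Sum>k = 0..<n. Polynomial.monom (coeff r k) k)" if "degree r < n" for r :: "real poly"
    proof -
      have "r = (\<Sum>k\<le>n - 1. Polynomial.monom (coeff r k) k)"
        using poly_as_sum_of_monoms'[of r "n - 1"] that by simp
      also have "{..n - 1} = {0..<n}" using that by auto
      finally show ?thesis .
    qed
    have "p * q = (\<Sum>k = 0..<n. \<Sum>l = 0..<n. Polynomial.monom (coeff p k * coeff q l) (k + l))"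
      by (subst expand[OF that(1)], subst expand[OF that(2)])
        (simp add: sum_product mult_monom)
    then show ?thesis by (simp add: sum_add moment_functional_monom mult_ac)
  qed
  have "U * H * transpose_mat U = E"
  proof (rule eq_matI)
    fix i j assume "i < dim_row E" "j < dim_col E"
    then have ij: "i < n" "j < n" by (simp_all add: E_def)
    have d: "degree (Q i) < n" "degree (Q j) < n"
      using deg[of i] deg[of j] ij by linarith+
    have "(U * H * transpose_mat U) $$ (i, j) =
        (\<Sum>l = 0..<n. (\<Sum>k = 0..<n. coeff (Q i) k * \<nu> (k + l)) * coeff (Q j) l)"
      using ij by (simp add: U_def H_def scalar_prod_def)
    also have "\<dots> = (\<Sum>k = 0..<n. \<Sum>l = 0..<n. coeff (Q i) k * \<nu> (k + l) * coeff (Q j) l)"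
      by (subst sum.swap) (simp add: sum_distrib_right)
    also have "\<dots> = E $$ (i, j)"
      using orth[of i j] ij by (simp add: bilinear[OF d] E_def)
    finally show "(U * H * transpose_mat U) $$ (i, j) = E $$ (i, j)" .
  qed (simp_all add: U_def H_def E_def)
  then have "Determinant.det U * Determinant.det H * Determinant.det U = Determinant.det E"
    using carr det_mult[of "U * H" n "transpose_mat U"] det_mult[of U n H] det_transpose[of U n]
    by simp
  then show ?thesis by (simp add: detU detE H_def)
qed

section \<open>Moments of the weight\<close>

text \<open>The right half of the weight after moving its singularity to 0; the left half is its
  reflection with \<open>- t\<close> in place of \<open>t\<close>.\<close>

definition half_weight :: "real \<Rightarrow> real \<Rightarrow> real \<Rightarrow> real" where
  "half_weight \<gamma> t x = indicator {0<..} x * (x powr \<gamma> * exp (- x\<^sup>2 - t * x))"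

definition half_moment :: "real \<Rightarrow> real \<Rightarrow> nat \<Rightarrow> real" where
  "half_moment \<gamma> t k = (LINT x|lborel. x ^ k * half_weight \<gamma> t x)"

lemma half_weight_measurable [measurable]: "half_weight \<gamma> t \<in> borel_measurable borel"
  unfolding half_weight_def by measurable

lemma half_weight_nonneg: "half_weight \<gamma> t x \<ge> 0"
  by (simp add: half_weight_def)

text \<open>Euler's integral for \<open>Gamma (a + 1)\<close>; it supplies the dominating function
  for the half-line weight.\<close>

lemma integrable_powr_exp:
  assumes "a > -1"
  shows "integrable lborel (\<lambda>x::real. indicator {0<..} x * (x powr a * exp (- x)))"
proof (rule integrableI_nonneg)
  have "(\<integral>\<^sup>+ x. ennreal (indicator {0<..} x * (x powr a * exp (- x))) \<partial>lborel)
      \<le> (\<integral>\<^sup>+ x. ennreal (indicator {0..} x * x powr a / exp x) \<partial>lborel)"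
    by (intro nn_integral_mono) (auto simp: indicator_def exp_minus field_simps)
  also have "\<dots> = ennreal (Gamma (a + 1))"
    using Gamma_conv_nn_integral_real[of "a + 1"] assms by simp
  also have "\<dots> < \<infinity>" by simp
  finally show "(\<integral>\<^sup>+ x. ennreal (indicator {0<..} x * (x powr a * exp (- x))) \<partial>lborel) < \<infinity>" .
qed auto

lemma half_weight_integrable:
  assumes "\<gamma> > -1"
  shows "integrable lborel (\<lambda>x. x ^ k * half_weight \<gamma> t x)"
proof (rule Bochner_Integration.integrable_bound)
  have "real k + \<gamma> > -1" using assms by simp
  from integrable_powr_exp[OF this]
  show "integrable lborel (\<lambda>x. exp ((t - 1)\<^sup>2 / 4) *
      (indicator {0<..} x * (x powr (real k + \<gamma>) * exp (- x))))"
    by (rule integrable_mult_right)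
  \<comment> \<open>\<open>(t - 1)\<^sup>2 / 4\<close> is the maximum of
    \<open>- x\<^sup>2 - (t - 1) * x\<close>, so up to a constant the Gaussian factor is dominated
    by \<open>exp (- x)\<close>.\<close>
  have bound: "- x\<^sup>2 - t * x \<le> (t - 1)\<^sup>2 / 4 + - x" for x
  proof -
    have "(t - 1)\<^sup>2 / 4 + - x - (- x\<^sup>2 - t * x) = (x + (t - 1) / 2)\<^sup>2"
      by (simp add: power2_eq_square field_simps)
    then show ?thesis by (metis diff_ge_0_iff_ge zero_le_power2)
  qed
  have "norm (x ^ k * half_weight \<gamma> t x)
      \<le> norm (exp ((t - 1)\<^sup>2 / 4) * (indicator {0<..} x * (x powr (real k + \<gamma>) * exp (- x))))" for x
  proof (cases "x > 0")
    case True
    have "norm (x ^ k * half_weight \<gamma> t x) = x powr (real k + \<gamma>) * exp (- x\<^sup>2 - t * x)"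
      using True by (simp add: half_weight_def powr_add powr_realpow abs_mult)
    also have "\<dots> \<le> x powr (real k + \<gamma>) * exp ((t - 1)\<^sup>2 / 4 + - x)"
      using bound[of x] by (intro mult_left_mono) auto
    also have "\<dots> = norm (exp ((t - 1)\<^sup>2 / 4) * (indicator {0<..} x * (x powr (real k + \<gamma>) * exp (- x))))"
      using True by (simp only: exp_add) (simp add: abs_mult mult_ac)
    finally show ?thesis .
  qed (simp add: half_weight_def)
  then show "AE x in lborel. norm (x ^ k * half_weight \<gamma> t x)
      \<le> norm (exp ((t - 1)\<^sup>2 / 4) * (indicator {0<..} x * (x powr (real k + \<gamma>) * exp (- x))))"
    by simp
qed auto

text \<open>Follows from \<open>1 + v \<le> exp v\<close> at \<open>u\<close> and at
  \<open>- u\<close>. The bound controls the second-order remainder under the integral.\<close>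

lemma exp_remainder_bound:
  fixes u :: real
  shows "\<bar>exp u - 1 - u\<bar> \<le> u\<^sup>2 * exp \<bar>u\<bar>"
proof -
  have low: "exp v - 1 - v \<ge> 0" for v :: real
    using exp_ge_add_one_self[of v] by linarith
  have "exp u * (1 - u) \<le> exp u * exp (- u)"
    using exp_ge_add_one_self[of "- u"] by (intro mult_left_mono) auto
  then have 1: "exp u - 1 - u \<le> u * (exp u - 1)"
    by (simp add: exp_minus algebra_simps)
  have "u * (exp u - 1) \<le> u\<^sup>2 * exp \<bar>u\<bar>"
  proof (cases "u \<ge> 0")
    case True
    have "exp u - 1 \<le> u * exp u"
      using \<open>exp u * (1 - u) \<le> exp u * exp (- u)\<close> by (simp add: exp_minus algebra_simps)
    then show ?thesis using True mult_left_mono[of "exp u - 1" "u * exp u" u]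
      by (simp add: power2_eq_square mult_ac)
  next
    case False
    have "(- u) * (1 - exp u) \<le> (- u) * (- u)"
      using low[of u] False by (intro mult_left_mono) auto
    also have "\<dots> \<le> u\<^sup>2 * exp \<bar>u\<bar>"
      by (simp add: power2_eq_square[symmetric] mult_left_mono[of 1 "exp \<bar>u\<bar>" "u\<^sup>2", simplified])
    finally show ?thesis by (simp add: algebra_simps)
  qed
  with 1 low[of u] show ?thesis by linarith
qed

text \<open>For \<open>\<bar>h\<bar> \<le> 1\<close> the second-order remainder is bounded pointwise
  by \<open>h\<^sup>2\<close> times an integrable function independent of \<open>h\<close>, so the
  difference quotient is within \<open>\<bar>h\<bar> * ?K\<close> of its limit.\<close>

lemma half_moment_deriv:
  assumes "\<gamma> > -1"
  shows "((\<lambda>s. half_moment \<gamma> s k) has_real_derivative - half_moment \<gamma> t (Suc k)) (at t)"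
proof -
  \<comment> \<open>The square of \<open>x\<close> in the remainder raises \<open>k\<close> to
    \<open>k + 2\<close>, and \<open>exp \<bar>h * x\<bar> \<le> exp x\<close> lowers
    \<open>t\<close> to \<open>t - 1\<close>.\<close>
  let ?K = "half_moment \<gamma> (t - 1) (k + 2)"
  have est: "\<bar>half_moment \<gamma> (t + h) k - half_moment \<gamma> t k + h * half_moment \<gamma> t (Suc k)\<bar> \<le> h\<^sup>2 * ?K"
    if "\<bar>h\<bar> \<le> 1" for h
  proof -
    have eq: "half_moment \<gamma> (t + h) k - half_moment \<gamma> t k + h * half_moment \<gamma> t (Suc k)
      = (LINT x|lborel. x ^ k * half_weight \<gamma> (t + h) x - x ^ k * half_weight \<gamma> t x
           + h * (x ^ Suc k * half_weight \<gamma> t x))"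
      unfolding half_moment_def using half_weight_integrable[OF assms]
      by (simp del: power_Suc)
    have "norm \<dots> \<le> (LINT x|lborel. h\<^sup>2 * (x ^ (k + 2) * half_weight \<gamma> (t - 1) x))"
    proof (rule Bochner_Integration.integral_norm_bound_integral)
      fix x :: real
      show "norm (x ^ k * half_weight \<gamma> (t + h) x - x ^ k * half_weight \<gamma> t x
           + h * (x ^ Suc k * half_weight \<gamma> t x)) \<le> h\<^sup>2 * (x ^ (k + 2) * half_weight \<gamma> (t - 1) x)"
      proof (cases "x > 0")
        case True
        define c where "c = x ^ k * half_weight \<gamma> t x"
        have c: "c \<ge> 0" using True by (simp add: c_def half_weight_nonneg)
        have shift: "half_weight \<gamma> (t + r) x = half_weight \<gamma> t x * exp (- r * x)" for r
          by (simp add: half_weight_def exp_add[symmetric] algebra_simps)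
        have "\<bar>exp (- h * x) - 1 - (- h * x)\<bar> \<le> (- h * x)\<^sup>2 * exp \<bar>- h * x\<bar>"
          by (rule exp_remainder_bound)
        also have "\<dots> \<le> (- h * x)\<^sup>2 * exp x"
          using that True by (intro mult_left_mono) (auto simp: abs_mult mult_left_le_one_le)
        finally have "c * \<bar>exp (- h * x) - 1 - (- h * x)\<bar> \<le> c * ((- h * x)\<^sup>2 * exp x)"
          using c by (rule mult_left_mono)
        moreover have "x ^ k * half_weight \<gamma> (t + h) x - x ^ k * half_weight \<gamma> t x
           + h * (x ^ Suc k * half_weight \<gamma> t x) = c * (exp (- h * x) - 1 - (- h * x))"
          unfolding shift c_def by (simp add: algebra_simps)
        moreover have "h\<^sup>2 * (x ^ (k + 2) * half_weight \<gamma> (t - 1) x) = c * ((- h * x)\<^sup>2 * exp x)"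
          using shift[of "-1"] unfolding c_def by (simp add: power_add power_mult_distrib power2_eq_square)
        ultimately show ?thesis using c by (simp add: abs_mult)
      qed (simp add: half_weight_def)
    qed (use half_weight_integrable[OF assms] in \<open>auto simp del: power_Suc\<close>)
    also have "\<dots> = h\<^sup>2 * ?K" by (simp add: half_moment_def)
    finally show ?thesis using eq by simp
  qed
  have "((\<lambda>h. (half_moment \<gamma> (t + h) k - half_moment \<gamma> t k) / h) \<longlongrightarrow> - half_moment \<gamma> t (Suc k)) (at 0)"
  proof (rule LIM_zero_cancel)
    have lim: "((\<lambda>h. \<bar>h\<bar> * ?K) \<longlongrightarrow> 0) (at 0)"
      by (auto intro!: tendsto_eq_intros)
    show "((\<lambda>h. (half_moment \<gamma> (t + h) k - half_moment \<gamma> t k) / h - - half_moment \<gamma> t (Suc k)) \<longlongrightarrow> 0) (at 0)"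
    proof (rule Lim_null_comparison[OF _ lim])
      have "eventually (\<lambda>h::real. h \<noteq> 0 \<and> \<bar>h\<bar> \<le> 1) (at 0)"
        unfolding eventually_at by (rule exI[of _ 1]) (auto simp: dist_real_def)
      then show "eventually (\<lambda>h. norm ((half_moment \<gamma> (t + h) k - half_moment \<gamma> t k) / h
          - - half_moment \<gamma> t (Suc k)) \<le> \<bar>h\<bar> * ?K) (at 0)"
      proof eventually_elim
        case (elim h)
        have "norm ((half_moment \<gamma> (t + h) k - half_moment \<gamma> t k) / h - - half_moment \<gamma> t (Suc k))
          = \<bar>half_moment \<gamma> (t + h) k - half_moment \<gamma> t k + h * half_moment \<gamma> t (Suc k)\<bar> / \<bar>h\<bar>"
          using elim by (simp add: add_divide_distrib flip: abs_divide)
        also have "\<dots> \<le> h\<^sup>2 * ?K / \<bar>h\<bar>"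
          using est elim by (intro divide_right_mono) auto
        also have "\<dots> = \<bar>h\<bar> * ?K"
          using elim by (simp add: power2_eq_square field_simps abs_if)
        finally show ?case .
      qed
    qed
  qed
  then show ?thesis by (simp add: DERIV_def)
qed

text \<open>Integration by parts: \<open>f\<close> is the derivative of \<open>F\<close>, which
  tends to 0 at 0 because \<open>a > 0\<close> and at infinity by Gaussian decay.\<close>

lemma half_moment_recurrence:
  assumes "\<gamma> > -1"
  shows "(real k + 1 + \<gamma>) * half_moment \<gamma> t k - 2 * half_moment \<gamma> t (k + 2)
     - t * half_moment \<gamma> t (Suc k) = 0"
proof -
  define a where "a = real k + 1 + \<gamma>"
  have a: "a > 0" using assms by (simp add: a_def)
  define F where "F = (\<lambda>x::real. x powr a * exp (- x\<^sup>2 - t * x))"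
  define f where "f = (\<lambda>x::real. (a * x ^ k - 2 * x ^ (k + 2) - t * x ^ Suc k)
     * (x powr \<gamma> * exp (- x\<^sup>2 - t * x)))"
  let ?g = "\<lambda>x. a * (x ^ k * half_weight \<gamma> t x) - 2 * (x ^ (k + 2) * half_weight \<gamma> t x)
     - t * (x ^ Suc k * half_weight \<gamma> t x)"
  have g: "?g x = indicator {0<..} x * f x" for x
    by (simp add: f_def half_weight_def algebra_simps)
  have int: "integrable lborel ?g"
    using half_weight_integrable[OF assms] by (auto simp del: power_Suc)
  have ival: "einterval 0 \<infinity> = {0<..}" by (auto simp: einterval_def)
  have "(LBINT x=0..\<infinity>. f x) = 0 - 0"
  proof (rule interval_integral_FTC_integrable)
    fix x :: real assume "0 < ereal x"
    then have x: "x > 0" by simp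
    have "((\<lambda>x. exp (- x\<^sup>2 - t * x)) has_real_derivative
        (- 2 * x - t) * exp (- x\<^sup>2 - t * x)) (at x)"
      by (auto intro!: derivative_eq_intros)
    from DERIV_mult[OF has_real_derivative_powr[OF x, of a] this]
    have "(F has_real_derivative a * x powr (a - 1) * exp (- x\<^sup>2 - t * x)
        + (- 2 * x - t) * exp (- x\<^sup>2 - t * x) * x powr a) (at x)"
      unfolding F_def .
    moreover have "x powr (a - 1) = x ^ k * x powr \<gamma>" "x powr a = x ^ Suc k * x powr \<gamma>"
      using x by (simp_all add: a_def powr_add powr_realpow)
    ultimately have "(F has_real_derivative f x) (at x)"
      by (simp add: f_def algebra_simps)
    then show "(F has_vector_derivative f x) (at x)"
      by (rule has_real_derivative_iff_has_vector_derivative[THEN iffD1])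
    show "isCont f x"
      unfolding f_def using x by (auto intro!: continuous_intros)
  next
    show "set_integrable lborel (einterval 0 \<infinity>) f"
      using int unfolding g ival set_integrable_def by simp
    have "(F \<longlongrightarrow> 0) (at_right 0)"
      unfolding F_def using a by real_asymp
    then show "((F \<circ> real_of_ereal) \<longlongrightarrow> 0) (at_right 0)"
      by (simp add: ereal_tendsto_simps zero_ereal_def)
    have "(F \<longlongrightarrow> 0) at_top"
      unfolding F_def using a by real_asymp
    then show "((F \<circ> real_of_ereal) \<longlongrightarrow> 0) (at_left \<infinity>)"
      by (simp add: ereal_tendsto_simps)
  qed simp
  moreover have "(LBINT x=0..\<infinity>. f x) = integral\<^sup>L lborel ?g"
    unfolding g by (simp add: interval_lebesgue_integral_def ival set_lebesgue_integral_def)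
  moreover have "integral\<^sup>L lborel ?g = a * half_moment \<gamma> t k - 2 * half_moment \<gamma> t (k + 2)
     - t * half_moment \<gamma> t (Suc k)"
    unfolding half_moment_def using half_weight_integrable[OF assms] by (simp del: power_Suc)
  ultimately show ?thesis by (simp add: a_def)
qed

section \<open>The two-sided weight\<close>

text \<open>Moments about the jump at \<open>t\<close>. Reflecting the left half-line, where the
  factor is \<open>A\<close>, produces \<open>(-1) ^ k\<close> and \<open>- t\<close>.\<close>

definition full_moment :: "real \<Rightarrow> real \<Rightarrow> real \<Rightarrow> real \<Rightarrow> nat \<Rightarrow> real" where
  "full_moment A B \<gamma> t k =
     (A + B) * half_moment \<gamma> t k + A * ((-1) ^ k * half_moment \<gamma> (- t) k)"

lemma weight_shift:
  "weight A B (t + x) t \<gamma> = (A + B) * half_weight \<gamma> t x + A * half_weight \<gamma> (- t) (- x)"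
proof -
  have "- (t + x)\<^sup>2 + t * (t + x) = - x\<^sup>2 - t * x"
    by (simp add: power2_eq_square algebra_simps)
  \<comment> \<open>At \<open>x = 0\<close> both sides are 0, because
    \<open>0 powr \<gamma> = 0\<close>.\<close>
  then show ?thesis
    by (auto simp: weight_def half_weight_def heaviside_def indicator_def)
qed

text \<open>On the reflected half the chain rule gives an extra sign, which
  \<open>(-1) ^ Suc k\<close> absorbs.\<close>

lemma full_moment_deriv:
  assumes "\<gamma> > -1"
  shows "((\<lambda>s. full_moment A B \<gamma> s k) has_real_derivative - full_moment A B \<gamma> t (Suc k)) (at t)"
proof -
  have "((\<lambda>s. half_moment \<gamma> (- s) k) has_real_derivative - half_moment \<gamma> (- t) (Suc k) * (- 1)) (at t)"
    by (rule DERIV_chain2[OF half_moment_deriv[OF assms]]) (auto intro!: derivative_eq_intros)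
  then show ?thesis
    unfolding full_moment_def
    by (auto intro!: derivative_eq_intros half_moment_deriv[OF assms])
qed

lemma full_moment_recurrence:
  assumes "\<gamma> > -1"
  shows "(real k + 1 + \<gamma>) * full_moment A B \<gamma> t k - 2 * full_moment A B \<gamma> t (k + 2)
     - t * full_moment A B \<gamma> t (Suc k) = 0"
proof -
  have "(real k + 1 + \<gamma>) * full_moment A B \<gamma> t k - 2 * full_moment A B \<gamma> t (k + 2)
     - t * full_moment A B \<gamma> t (Suc k)
   = (A + B) * ((real k + 1 + \<gamma>) * half_moment \<gamma> t k - 2 * half_moment \<gamma> t (k + 2)
        - t * half_moment \<gamma> t (Suc k))
     + A * (-1) ^ k * ((real k + 1 + \<gamma>) * half_moment \<gamma> (- t) k - 2 * half_moment \<gamma> (- t) (k + 2)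
        - (- t) * half_moment \<gamma> (- t) (Suc k))"
    by (simp add: full_moment_def algebra_simps)
  then show ?thesis by (simp only: half_moment_recurrence[OF assms])
qed

lemma has_bochner_integral_weight_moment:
  assumes "\<gamma> > -1"
  shows "has_bochner_integral lborel (\<lambda>x. x ^ k * weight A B (t + x) t \<gamma>) (full_moment A B \<gamma> t k)"
proof -
  have 1: "has_bochner_integral lborel (\<lambda>x. x ^ k * half_weight \<gamma> t x) (half_moment \<gamma> t k)"
    unfolding half_moment_def using half_weight_integrable[OF assms] by (rule has_bochner_integral_integrable)
  have "has_bochner_integral lborel (\<lambda>x. x ^ k * half_weight \<gamma> (- t) x) (half_moment \<gamma> (- t) k)"
    unfolding half_moment_def using half_weight_integrable[OF assms] by (rule has_bochner_integral_integrable)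
  then have 2: "has_bochner_integral lborel (\<lambda>x. (- x) ^ k * half_weight \<gamma> (- t) (- x)) (half_moment \<gamma> (- t) k)"
    by (subst (asm) lborel_has_bochner_integral_real_affine_iff[of "-1" _ _ 0]) simp_all
  have "has_bochner_integral lborel
     (\<lambda>x. (A + B) * (x ^ k * half_weight \<gamma> t x) + A * ((-1) ^ k * ((- x) ^ k * half_weight \<gamma> (- t) (- x))))
     (full_moment A B \<gamma> t k)"
    unfolding full_moment_def
    by (intro has_bochner_integral_add has_bochner_integral_mult_right 1 2)
  moreover have "(A + B) * (x ^ k * half_weight \<gamma> t x) + A * ((-1) ^ k * ((- x) ^ k * half_weight \<gamma> (- t) (- x)))
      = x ^ k * weight A B (t + x) t \<gamma>" for x
  proof -
    have "(-1) ^ k * ((- x) ^ k) = x ^ k" by (simp flip: power_mult_distrib)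
    then have "(-1) ^ k * ((- x) ^ k * half_weight \<gamma> (- t) (- x)) = x ^ k * half_weight \<gamma> (- t) (- x)"
      by (metis mult.assoc)
    then show ?thesis by (simp add: weight_shift algebra_simps)
  qed
  ultimately show ?thesis by simp
qed

lemma has_bochner_integral_moment_functional:
  fixes w :: "real \<Rightarrow> real"
  assumes "\<And>k. has_bochner_integral lborel (\<lambda>x. x ^ k * w x) (\<nu> k)"
  shows "has_bochner_integral lborel (\<lambda>x. poly p x * w x) (moment_functional \<nu> p)"
proof -
  have "has_bochner_integral lborel (\<lambda>x. \<Sum>i\<le>degree p. coeff p i * (x ^ i * w x)) (moment_functional \<nu> p)"
    unfolding moment_functional_def
    by (intro has_bochner_integral_sum has_bochner_integral_mult_right assms)
  then show ?thesis by (simp add: poly_altdef sum_distrib_right mult.assoc)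
qed

text \<open>Reduces the Pearson relation to monomials, where it is the recurrence of the
  moments.\<close>

lemma additive_eq_0_if_monom:
  fixes G :: "real poly \<Rightarrow> real"
  assumes "\<And>p q. G (p + q) = G p + G q" and "\<And>c k. G (Polynomial.monom c k) = 0"
  shows "G p = 0"
proof -
  have "G (\<Sum>i\<in>I. Polynomial.monom (coeff p i) i) = 0" if "finite I" for I
    using that by (induction I rule: finite_induct) (use assms(2)[of 0 0] in \<open>auto simp: assms\<close>)
  then show ?thesis using poly_as_sum_of_monoms[of p] by (metis finite_atMost)
qed

lemma X_mult_monom: "X * Polynomial.monom c k = Polynomial.monom c (Suc k)"
  by (simp add: X_def monom_Suc)

lemma weight_nonneg:
  assumes "A \<ge> 0" "A + B \<ge> 0"
  shows "weight A B z t \<gamma> \<ge> 0"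
  using assms by (auto simp: weight_def heaviside_def)

text \<open>A zero integral would make \<open>p * p\<close> times the weight vanish almost
  everywhere; the weight is positive on an interval of length 1 and \<open>p\<close> has finitely
  many roots, so that interval would be null.\<close>

lemma moment_functional_weight_pos:
  assumes "A \<ge> 0" "A + B \<ge> 0" "A \<noteq> 0 \<or> A + B \<noteq> 0" "\<gamma> > -1" "p \<noteq> 0"
  shows "moment_functional (full_moment A B \<gamma> t) (p * p) > 0"
proof -
  let ?W = "\<lambda>x. weight A B (t + x) t \<gamma>"
  have I: "has_bochner_integral lborel (\<lambda>x. poly (p * p) x * ?W x)
      (moment_functional (full_moment A B \<gamma> t) (p * p))"
    by (intro has_bochner_integral_moment_functional has_bochner_integral_weight_moment assms)
  have nn: "poly (p * p) x * ?W x \<ge> 0" for x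
    using weight_nonneg[OF assms(1,2)] by simp
  \<comment> \<open>The interval is \<open>(0, 1)\<close> if the right factor \<open>A + B\<close>
    is positive, and \<open>(-1, 0)\<close> otherwise.\<close>
  obtain c :: real where c: "?W x > 0" if "x \<in> {c<..<c + 1}" for x
  proof (cases "A + B > 0")
    case True
    then have "?W x > 0" if "x \<in> {0<..<0 + 1}" for x
      using that by (simp add: weight_def heaviside_def)
    then show ?thesis by (rule that)
  next
    case False
    then have "A > 0" using assms by linarith
    then have "?W x > 0" if "x \<in> {-1<..<-1 + 1}" for x
      using that by (simp add: weight_def heaviside_def)
    then show ?thesis by (rule that)
  qed
  have "moment_functional (full_moment A B \<gamma> t) (p * p) \<noteq> 0"
  proof
    assume "moment_functional (full_moment A B \<gamma> t) (p * p) = 0"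
    then have "AE x in lborel. poly (p * p) x * ?W x = 0"
      using I nn integral_nonneg_eq_0_iff_AE[of lborel "\<lambda>x. poly (p * p) x * ?W x"]
      by (auto simp: has_bochner_integral_iff)
    moreover have "AE x in lborel. x \<notin> {x. poly p x = 0}"
      using poly_roots_finite[OF assms(5)] by (intro AE_not_in finite_imp_null_set_lborel)
    ultimately have "AE x in lborel. x \<notin> {c<..<c + 1}"
      by eventually_elim (use c in force)
    then have "{c<..<c + 1} \<in> null_sets lborel"
      by (subst AE_iff_null_sets) auto
    then show False by (simp add: null_sets_def)
  qed
  moreover have "moment_functional (full_moment A B \<gamma> t) (p * p) \<ge> 0"
    unfolding has_bochner_integral_integral_eq[OF I, symmetric]
    by (rule Bochner_Integration.integral_nonneg) (rule nn)
  ultimately show ?thesis by simp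
qed

lemma toda_flow_full_moment:
  assumes "A \<ge> 0" "A + B \<ge> 0" "A \<noteq> 0 \<or> A + B \<noteq> 0" "\<gamma> > -1"
  shows "toda_flow (full_moment A B \<gamma>) \<gamma>"
proof (rule toda_flow.intro)
  show "((\<lambda>s. full_moment A B \<gamma> s k) has_real_derivative - full_moment A B \<gamma> t (Suc k)) (at t)" for k t
    by (rule full_moment_deriv) fact
  fix t
  let ?M = "moment_functional (full_moment A B \<gamma> t)"
  show "pearson_functional ?M \<gamma> t"
  proof
    show "?M (p + q) = ?M p + ?M q" for p q by (rule moment_functional_add)
    show "?M (Polynomial.smult c p) = c * ?M p" for c p by (rule moment_functional_smult)
    show "?M (p * p) > 0" if "p \<noteq> 0" for p
      using moment_functional_weight_pos assms that by blast
    define \<Phi> where "\<Phi> = (\<lambda>p. p + X * pderiv p + Polynomial.smult \<gamma> p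
      - Polynomial.smult 2 (X * X * p) - Polynomial.smult t (X * p))"
    have "\<Phi> (p + q) = \<Phi> p + \<Phi> q" for p q
      by (simp add: \<Phi>_def pderiv_add smult_add_right algebra_simps)
    then have add: "?M (\<Phi> (p + q)) = ?M (\<Phi> p) + ?M (\<Phi> q)" for p q
      by (simp add: moment_functional_add)
    have "?M (\<Phi> (Polynomial.monom c k)) = 0" for c k
    proof -
      have "X * pderiv (Polynomial.monom c k) = Polynomial.monom (real k * c) k"
        by (cases k) (simp_all add: pderiv_monom X_mult_monom)
      then have "\<Phi> (Polynomial.monom c k) = Polynomial.monom (c * (real k + 1 + \<gamma>)) k
          + Polynomial.monom (- 2 * c) (k + 2) + Polynomial.monom (- t * c) (Suc k)"
        by (simp add: \<Phi>_def X_mult_monom mult.assoc smult_monom poly_eq_iff algebra_simps)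
      then have "?M (\<Phi> (Polynomial.monom c k)) = c * ((real k + 1 + \<gamma>) * full_moment A B \<gamma> t k
          - 2 * full_moment A B \<gamma> t (k + 2) - t * full_moment A B \<gamma> t (Suc k))"
        by (simp add: moment_functional_add moment_functional_monom algebra_simps)
      then show ?thesis by (simp only: full_moment_recurrence[OF assms(4)])
    qed
    from additive_eq_0_if_monom[of "\<lambda>p. ?M (\<Phi> p)", OF add this]
    show "?M (p + X * pderiv p + Polynomial.smult \<gamma> p
      - Polynomial.smult 2 (X * X * p) - Polynomial.smult t (X * p)) = 0" for p
      by (simp add: \<Phi>_def)
  qed
qed

text \<open>The entries of the determinant are moments about 0, while the functional is centred at
  \<open>t\<close>. Translating the orthogonal polynomials by \<open>t\<close> keeps them monic with
  the same norms, so \<open>det_hankel_orthogonal\<close> applies.\<close>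

lemma hankel_det_eq_prod_hn:
  assumes "\<gamma> > -1" and "positive_functional (moment_functional (full_moment A B \<gamma> t))"
  shows "hankel_det A B \<gamma> n t =
    (\<Prod>j<n. positive_functional.hn (moment_functional (full_moment A B \<gamma> t)) j)"
proof -
  let ?M = "moment_functional (full_moment A B \<gamma> t)"
  interpret F: positive_functional ?M by fact
  define \<nu> where "\<nu> = (\<lambda>k. LINT z|lborel. z ^ k * weight A B z t \<gamma>)"
  have M: "has_bochner_integral lborel (\<lambda>x. poly p x * weight A B (t + x) t \<gamma>) (?M p)" for p
    by (intro has_bochner_integral_moment_functional has_bochner_integral_weight_moment assms)
  have shift: "has_bochner_integral lborel (\<lambda>z. poly q z * weight A B z t \<gamma>) (?M (q \<circ>\<^sub>p [:t, 1:]))" for q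
    using lborel_has_bochner_integral_real_affine_iff[of 1 "\<lambda>z. poly q z * weight A B z t \<gamma>" _ t]
      M[of "q \<circ>\<^sub>p [:t, 1:]"]
    by (simp add: poly_pcompose)
  have "has_bochner_integral lborel (\<lambda>z. z ^ k * weight A B z t \<gamma>) (\<nu> k)" for k
    using shift[of "Polynomial.monom 1 k"] unfolding \<nu>_def
    by (simp add: poly_monom has_bochner_integral_iff)
  then have \<nu>: "moment_functional \<nu> q = ?M (q \<circ>\<^sub>p [:t, 1:])" for q
    by (rule has_bochner_integral_eq[OF has_bochner_integral_moment_functional shift])
  define Q where "Q = (\<lambda>i. F.opoly (Suc i) \<circ>\<^sub>p [:- t, 1:])"
  have degF: "degree (F.opoly (Suc i)) = i" for i
    using F.degree_opoly_Suc_le[of i] F.lead_opoly[of i] le_degree[of "F.opoly (Suc i)" i] by simp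
  have degQ: "degree (Q i) = i" for i
    by (simp add: Q_def degree_pcompose degF)
  have monic: "coeff (Q i) i = 1" for i
    using lead_coeff_comp[of "[:- t, 1:]" "F.opoly (Suc i)"] degQ[of i] by (simp add: Q_def degF)
  have unshift: "Q i \<circ>\<^sub>p [:t, 1:] = F.opoly (Suc i)" for i
    unfolding Q_def pcompose_assoc[symmetric] by (simp add: pcompose_pCons pcompose_idR)
  have "moment_functional \<nu> (Q i * Q j) = (if i = j then F.hn i else 0)" for i j
    using F.orthogonal[of "Suc i" "Suc j"] F.orthogonal[of "Suc j" "Suc i"]
    by (cases i j rule: linorder_cases) (auto simp: \<nu> pcompose_mult unshift F.hn_def mult.commute)
  from det_hankel_orthogonal[of Q \<nu> F.hn n, OF _ monic this] show ?thesis
    by (simp add: hankel_det_def \<nu>_def degQ)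
qed

section \<open>The sigma-form and its Okamoto normalization\<close>

theorem theorem5p1:
  fixes A B \<gamma> :: real and n :: nat
  assumes "A \<ge> 0" and "A + B \<ge> 0" and "\<gamma> > -1"
  shows "(\<forall>t. (\<lambda>s. ln (hankel_det A B \<gamma> n s)) field_differentiable at t \<and>
              sigma_n A B \<gamma> n field_differentiable at t \<and>
              deriv (sigma_n A B \<gamma> n) field_differentiable at t \<and>
              (deriv (deriv (sigma_n A B \<gamma> n)) t)\<^sup>2 =
                1 / 4 * (t * deriv (sigma_n A B \<gamma> n) t - sigma_n A B \<gamma> n t)\<^sup>2
                - 4 * (deriv (sigma_n A B \<gamma> n) t - real n / 2) * deriv (sigma_n A B \<gamma> n) t
                    * (deriv (sigma_n A B \<gamma> n) t - (real n + \<gamma>) / 2)) \<and>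
         JMO_sigma_PIV (- real n) (- (real n + \<gamma>)) (\<lambda>s. 2 * sigma_n A B \<gamma> n (2 * s))"
proof -
  obtain S S1 S2 where
    S: "\<And>t. ((\<lambda>s. ln (hankel_det A B \<gamma> n s)) has_real_derivative S t) (at t)" and
    S1: "\<And>t. (S has_real_derivative S1 t) (at t)" and
    S2: "\<And>t. (S1 has_real_derivative S2 t) (at t)" and
    eq: "\<And>t. (S2 t)\<^sup>2 = 1 / 4 * (t * S1 t - S t)\<^sup>2
        - 4 * (S1 t - real n / 2) * S1 t * (S1 t - (real n + \<gamma>) / 2)"
  proof (cases "A = 0 \<and> A + B = 0")
    case True
    \<comment> \<open>The weight vanishes, so the determinant and its logarithm do not depend on
      \<open>s\<close>.\<close>
    then have "A = 0" "B = 0" by auto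
    then have "hankel_det A B \<gamma> n s = Determinant.det (Matrix.mat n n (\<lambda>(i, j). 0))" for s
      by (simp add: hankel_det_def weight_def)
    then show ?thesis
      by (intro that[of "\<lambda>_. 0" "\<lambda>_. 0" "\<lambda>_. 0"]) simp_all
  next
    case False
    then interpret T: toda_flow "full_moment A B \<gamma>" \<gamma>
      using assms by (intro toda_flow_full_moment) auto
    have "hankel_det A B \<gamma> n s = (\<Prod>j<n. T.F.hn s j)" for s
      by (rule hankel_det_eq_prod_hn) (fact assms, unfold_locales)
    \<comment> \<open>\<open>S\<close> is \<open>T.sig n\<close>, \<open>S1\<close> is the
      coefficient \<open>beta\<close> at \<open>n\<close>, and \<open>S2\<close> is its velocity
      along the flow.\<close>
    then show ?thesis
      using T.ln_prod_hn_deriv[of n]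
      by (intro that[OF _ T.sig_deriv T.beta_deriv T.sigma_form]) simp
  qed
  have \<sigma>: "sigma_n A B \<gamma> n = S"
    unfolding sigma_n_def by (rule ext) (rule DERIV_imp_deriv[OF S])
  have d1: "deriv S = S1"
    by (rule ext) (rule DERIV_imp_deriv[OF S1])
  have d2: "deriv S1 = S2"
    by (rule ext) (rule DERIV_imp_deriv[OF S2])
  have h1: "((\<lambda>s. 2 * S (2 * s)) has_real_derivative 4 * S1 (2 * t)) (at t)" for t
    using DERIV_cmult[OF DERIV_chain2[OF S1[of "2 * t"] DERIV_cmult_Id], of 2] by simp
  have h2: "((\<lambda>s. 4 * S1 (2 * s)) has_real_derivative 8 * S2 (2 * t)) (at t)" for t
    using DERIV_cmult[OF DERIV_chain2[OF S2[of "2 * t"] DERIV_cmult_Id], of 4] by simp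
  have dh1: "deriv (\<lambda>s. 2 * S (2 * s)) = (\<lambda>t. 4 * S1 (2 * t))"
    by (rule ext) (rule DERIV_imp_deriv[OF h1])
  have dh2: "deriv (\<lambda>s. 4 * S1 (2 * s)) = (\<lambda>t. 8 * S2 (2 * t))"
    by (rule ext) (rule DERIV_imp_deriv[OF h2])
  have fdI: "f field_differentiable at t" if "(f has_real_derivative d) (at t)" for f d and t :: real
    using that by (auto simp: field_differentiable_def)
  \<comment> \<open>This is 64 times the sigma-form at \<open>2 * s\<close>; the linear factors are
    \<open>4 * (S1 - n / 2)\<close> and \<open>4 * (S1 - (n + \<gamma>) / 2)\<close>.\<close>
  have JMO: "(8 * S2 (2 * s))\<^sup>2 - 4 * (s * (4 * S1 (2 * s)) - 2 * S (2 * s))\<^sup>2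
      + 4 * (4 * S1 (2 * s)) * (4 * S1 (2 * s) + 2 * - real n) * (4 * S1 (2 * s) + 2 * - (real n + \<gamma>)) = 0" for s
  proof -
    have "(8 * S2 (2 * s))\<^sup>2 = 64 * (S2 (2 * s))\<^sup>2" by (simp add: power_mult_distrib)
    then show ?thesis unfolding eq by (simp add: field_simps power2_eq_square)
  qed
  have "JMO_sigma_PIV (- real n) (- (real n + \<gamma>)) (\<lambda>s. 2 * S (2 * s))"
    unfolding JMO_sigma_PIV_def dh1 dh2
    by (intro allI conjI fdI[OF h1] fdI[OF h2] JMO)
  then show ?thesis
    unfolding \<sigma> d1 d2
    by (intro conjI allI fdI[OF S] fdI[OF S1]
        fdI[OF S2] eq)
qed

end
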